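(* Let $(M,\Delta,\alpha)$ be a partial dynamical system, let $Y\subset M$ be a closed set containing $M\setminus\alpha(\Delta)$, let $(\widetilde M,\widetilde\Delta,\widetilde\alpha)$ be the natural reversible extension of $(M,\alpha)$ associated with $Y$, and let $\Phi:\widetilde M\to M$, $\Phi(x_0,x_1,\dots)=x_0$, be the corresponding factor map. i) If $(M_\beta,\Delta_\beta,\beta)$ is a reversible extension of $(M,\alpha)$ associated with $Y$, and $\Psi:M_\beta\to M$ is the corresponding semiconjugacy, then there is a unique semiconjugacy $\widetilde\Psi$ from $(M_\beta,\beta)$ to $(\widetilde M,\widetilde\alpha)$ such that $\Psi=\Phi\circ\widetilde\Psi$ and $\widetilde\Psi(M_\beta\setminus\beta(\Delta_\beta))=\widetilde M\setminus\widetilde\alpha(\widetilde\Delta)$ (so that $(M_\beta,\beta)$ is an extension of $(\widetilde M,\widetilde\alpha)$ associated with $\widetilde M\setminus\widetilde\alpha(\widetilde\Delta)$). ii) If a partial dynamical system $(M_\beta,\Delta_\beta,\beta)$ has the property of $(\widetilde M,\widetilde\alpha)$ described in i), that is, it is a reversible extension of $(M,\alpha)$ associated with $Y$ via a semiconjugacy $\Psi:M_\beta\to M$, and for every reversible extension $(M_\theta,\Delta_\theta,\theta)$ of $(M,\alpha)$ associated with $Y$ with corresponding semiconjugacy $\Xi:M_\theta\to M$ there is a unique semiconjugacy $\widetilde\Xi$ from $(M_\theta,\theta)$ to $(M_\beta,\beta)$ with $\Xi=\Psi\circ\widetilde\Xi$ and $\widetilde\Xi(M_\theta\setminus\theta(\Delta_\theta))=M_\beta\setminus\beta(\Delta_\beta)$,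 then $(M_\beta,\beta)$ and $(\widetilde M,\widetilde\alpha)$ are equivalent, and the equivalence is established by the map $\widetilde\Psi$ from i).
   Context: A partial dynamical system is a triple $(M,\Delta,\alpha)$ with $M$ compact Hausdorff, $\Delta\subset M$ clopen and $\alpha:\Delta\to M$ continuous. It is reversible if $\alpha(\Delta)$ is open in $M$ and $\alpha:\Delta\to\alpha(\Delta)$ is a homeomorphism. A semiconjugacy (factor map) from $(M_\beta,\Delta_\beta,\beta)$ to $(M_\alpha,\Delta_\alpha,\alpha)$ is a continuous surjection $\Psi:M_\beta\to M_\alpha$ with $\Psi^{-1}(\Delta_\alpha)=\Delta_\beta$ and $\alpha(\Psi(x))=\Psi(\beta(x))$ for $x\in\Delta_\beta$; then $(M_\beta,\beta)$ is called an extension of $(M_\alpha,\alpha)$. The extension is associated with $Y\subset M_\alpha$ (with corresponding semiconjugacy $\Psi$) if $\Psi\big(\overline{M_\beta\setminus\beta(\Delta_\beta)}\big)=Y$. Two systems are equivalent if there is an injective semiconjugacy between them. The natural reversible extension of $(M,\Delta,\alpha)$ associated with a closed set $Y\supset M\setminus\alpha(\Delta)$ is $(\widetilde M,\widetilde\Delta,\widetilde\alpha)$, where $\widetilde M=\bigcup_{N=0}^\infty M_N\cup M_\infty\subset\prod_{n\in\mathbb N}(M\cup\{0\})$ (product topology, $0$ an added isolated point, $\mathbb N=\{0,1,\dots\}$), $M_N=\{(x_0,\dots,x_N,0,0,\dots): x_n\in\Delta,\ \alpha(x_n)=x_{n-1},\ n=1,\dots,N,\ x_N\in Y\}$, $M_\infty=\{(x_0,x_1,\dots):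 x_n\in\Delta,\ \alpha(x_n)=x_{n-1},\ n\ge1\}$ (here $x_0\in M$), $\widetilde\Delta=\{(x_0,x_1,\dots)\in\widetilde M: x_0\in\Delta\}$ and $\widetilde\alpha(x_0,x_1,\dots)=(\alpha(x_0),x_0,x_1,\dots)$. It is a reversible extension of $(M,\alpha)$ associated with $Y$, with semiconjugacy $\Phi$. *)

theory Defs
  imports "HOL-Analysis.Analysis"
begin

text \<open>The map is a total function of the logic; only its values on the domain matter.\<close>

record 'a pds =
  phase :: "'a topology"
  pdom :: "'a set"
  pmap :: "'a \<Rightarrow> 'a"

definition partial_dynamical_system :: "'a pds \<Rightarrow> bool" where
  "partial_dynamical_system A \<longleftrightarrow>
     compact_space (phase A) \<and> Hausdorff_space (phase A) \<and>
     openin (phase A) (pdom A) \<and> closedin (phase A) (pdom A) \<and>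
     continuous_map (subtopology (phase A) (pdom A)) (phase A) (pmap A)"

definition pran :: "'a pds \<Rightarrow> 'a set" where
  "pran A = pmap A ` pdom A"

definition reversible :: "'a pds \<Rightarrow> bool" where
  "reversible A \<longleftrightarrow>
     openin (phase A) (pran A) \<and>
     homeomorphic_map (subtopology (phase A) (pdom A)) (subtopology (phase A) (pran A)) (pmap A)"

definition semiconjugacy :: "'b pds \<Rightarrow> 'a pds \<Rightarrow> ('b \<Rightarrow> 'a) \<Rightarrow> bool" where
  "semiconjugacy B A \<Psi> \<longleftrightarrow>
     continuous_map (phase B) (phase A) \<Psi> \<and>
     \<Psi> ` topspace (phase B) = topspace (phase A) \<and>
     {x \<in> topspace (phase B). \<Psi> x \<in> pdom A} = pdom B \<and>
     (\<forall>x \<in> pdom B. pmap A (\<Psi> x) = \<Psi> (pmap B x))"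

definition equivalent_systems :: "'b pds \<Rightarrow> 'a pds \<Rightarrow> bool" where
  "equivalent_systems B A \<longleftrightarrow>
     (\<exists>\<Psi>. semiconjugacy B A \<Psi> \<and> inj_on \<Psi> (topspace (phase B)))"

definition extension_associated :: "'b pds \<Rightarrow> 'a pds \<Rightarrow> 'a set \<Rightarrow> ('b \<Rightarrow> 'a) \<Rightarrow> bool" where
  "extension_associated B A Y \<Psi> \<longleftrightarrow>
     partial_dynamical_system B \<and> semiconjugacy B A \<Psi> \<and>
     \<Psi> ` (phase B closure_of (topspace (phase B) - pran B)) = Y"

definition reversible_extension :: "'b pds \<Rightarrow> 'a pds \<Rightarrow> 'a set \<Rightarrow> ('b \<Rightarrow> 'a) \<Rightarrow> bool" where
  "reversible_extension B A Y \<Psi> \<longleftrightarrow> reversible B \<and> extension_associated B A Y \<Psi>"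

text \<open>
  A semiconjugacy \<open>\<Xi>'\<close> from \<open>T\<close> to \<open>B\<close> with \<open>\<Xi> = \<Psi> \<circ> \<Xi>'\<close> that maps the complement of the range
  of \<open>T\<close> onto the complement of the range of \<open>B\<close>. Such maps are determined only on the phase space
  of \<open>T\<close>; uniqueness has to be stated for \<open>extensional\<close> functions.
\<close>

definition lifting ::
  "'c pds \<Rightarrow> ('c \<Rightarrow> 'a) \<Rightarrow> 'b pds \<Rightarrow> ('b \<Rightarrow> 'a) \<Rightarrow> ('c \<Rightarrow> 'b) \<Rightarrow> bool" where
  "lifting T \<Xi> B \<Psi> \<Xi>' \<longleftrightarrow>
     semiconjugacy T B \<Xi>' \<and>
     (\<forall>x \<in> topspace (phase T). \<Xi> x = \<Psi> (\<Xi>' x)) \<and>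
     \<Xi>' ` (topspace (phase T) - pran T) = topspace (phase B) - pran B"

text \<open>
  The space \<open>X \<union> {0}\<close> with \<open>0\<close> an added isolated point: \<open>None\<close> is the point \<open>0\<close>. Since \<open>openin X\<close>
  holds only for subsets of the carrier of \<open>X\<close>, the new carrier is \<open>insert None (Some ` topspace X)\<close>.
\<close>

definition add_isolated_point :: "'a topology \<Rightarrow> 'a option topology" where
  "add_isolated_point X = topology (\<lambda>U. openin X (Some -` U))"

lemma openin_add_isolated_point:
  "openin (add_isolated_point X) U \<longleftrightarrow> openin X (Some -` U)"
proof -
  have "istopology (\<lambda>U. openin X (Some -` U))"
    unfolding istopology_def by (auto simp: vimage_Union)
  then show ?thesis
    unfolding add_isolated_point_def by (simp add: topology_inverse')
qed

lemma topspace_add_isolated_point: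
  "topspace (add_isolated_point X) = insert None (Some ` topspace X)" (is "_ = ?T")
proof
  have "Some -` ?T = topspace X" by auto
  then have "openin (add_isolated_point X) ?T" by (simp add: openin_add_isolated_point)
  then show "?T \<subseteq> topspace (add_isolated_point X)" by (rule openin_subset)
  have "openin X (Some -` topspace (add_isolated_point X))"
    using openin_topspace openin_add_isolated_point by blast
  then have "Some -` topspace (add_isolated_point X) \<subseteq> topspace X" by (rule openin_subset)
  then have "y \<in> ?T" if "y \<in> topspace (add_isolated_point X)" for y
    using that by (cases y) auto
  then show "topspace (add_isolated_point X) \<subseteq> ?T" by blast
qed

definition finite_orbits :: "'a pds \<Rightarrow> 'a set \<Rightarrow> nat \<Rightarrow> (nat \<Rightarrow> 'a option) set" where
  "finite_orbits A Y N =
     {(\<lambda>n. if n \<le> N then Some (u n) else None) | u.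
        u 0 \<in> topspace (phase A) \<and>
        (\<forall>n \<in> {1..N}. u n \<in> pdom A \<and> pmap A (u n) = u (n - 1)) \<and> u N \<in> Y}"

definition infinite_orbits :: "'a pds \<Rightarrow> (nat \<Rightarrow> 'a option) set" where
  "infinite_orbits A =
     {(\<lambda>n. Some (u n)) | u.
        u 0 \<in> topspace (phase A) \<and>
        (\<forall>n \<ge> 1. u n \<in> pdom A \<and> pmap A (u n) = u (n - 1))}"

definition orbit_space :: "'a pds \<Rightarrow> 'a set \<Rightarrow> (nat \<Rightarrow> 'a option) set" where
  "orbit_space A Y = (\<Union>N. finite_orbits A Y N) \<union> infinite_orbits A"

definition natural_extension :: "'a pds \<Rightarrow> 'a set \<Rightarrow> (nat \<Rightarrow> 'a option) pds" where
  "natural_extension A Y =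
     \<lparr> phase = subtopology (product_topology (\<lambda>_. add_isolated_point (phase A)) UNIV) (orbit_space A Y),
       pdom = {x \<in> orbit_space A Y. x 0 \<in> Some ` pdom A},
       pmap = (\<lambda>x. case_nat (map_option (pmap A) (x 0)) x) \<rparr>"

definition natural_factor_map :: "(nat \<Rightarrow> 'a option) \<Rightarrow> 'a" where
  "natural_factor_map x = the (x 0)"

end

theory Submission
  imports Defs
begin

text \<open>
  A lifting \<open>f\<close> of a reversible extension \<open>(B, \<beta>, \<Psi>)\<close> to the natural extension is forced: outside
  the range of \<open>\<beta>\<close> the sequence \<open>f y\<close> is not a shift, so it is \<open>(\<Psi> y, 0, 0, \<dots>)\<close>, and on the range
  \<open>f y\<close> is \<open>\<Psi> y\<close> followed by \<open>f (\<beta>\<^sup>-\<^sup>1 y)\<close>. The map defined by this recursion is continuous because the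
  range of \<open>\<beta>\<close> is clopen. Its image meets every finite prefix condition: to match the entries
  \<open>x\<^sub>0, \<dots>, x\<^sub>N\<close>, pick a point of \<open>B\<close> over \<open>x\<^sub>N\<close> and apply \<open>\<beta>\<close> to it \<open>N\<close> times; surjectivity
  follows by compactness. For the second part, the universal property of \<open>B\<close> yields a lifting \<open>\<Xi>'\<close>
  from the natural extension onto \<open>B\<close>. By uniqueness \<open>f \<circ> \<Xi>'\<close> is the identity, and since \<open>\<Xi>'\<close> is
  surjective, \<open>f\<close> is injective.
\<close>

section \<open>Adding an isolated point\<close>

lemma openin_image_Some: "openin (add_isolated_point X) (Some ` S) \<longleftrightarrow> openin X S"
  by (simp add: openin_add_isolated_point inj_vimage_image_eq)

lemma closedin_image_Some: "closedin (add_isolated_point X) (Some ` S) \<longleftrightarrow> closedin X S"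
proof -
  have "Some -` (insert None (Some ` topspace X) - Some ` S) = topspace X - S"
    by auto
  then show ?thesis
    by (auto simp: closedin_def topspace_add_isolated_point openin_add_isolated_point)
qed

lemma closedin_None: "closedin (add_isolated_point X) {None}"
proof -
  have "Some -` (insert None (Some ` topspace X) - {None}) = topspace X"
    by auto
  then show ?thesis
    by (simp add: closedin_def topspace_add_isolated_point openin_add_isolated_point)
qed

lemma continuous_map_Some: "continuous_map X (add_isolated_point X) Some"
proof -
  have "{x \<in> topspace X. Some x \<in> U} = Some -` U" if "openin X (Some -` U)" for U
    using openin_subset[OF that] by auto
  then show ?thesis
    by (auto simp: continuous_map_def topspace_add_isolated_point openin_add_isolated_point)
qed

lemma compact_space_add_isolated_point:
  assumes "compact_space X"
  shows "compact_space (add_isolated_point X)"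
proof -
  have "compactin (add_isolated_point X) (Some ` topspace X)"
    using assms continuous_map_Some image_compactin compact_space_def by blast
  moreover have "compactin (add_isolated_point X) {None}"
    by (simp add: topspace_add_isolated_point)
  ultimately show ?thesis
    using compactin_Un unfolding compact_space_def topspace_add_isolated_point
    by (metis insert_is_Un)
qed

lemma Hausdorff_space_add_isolated_point:
  assumes "Hausdorff_space X"
  shows "Hausdorff_space (add_isolated_point X)"
  unfolding Hausdorff_space_def
proof (intro allI impI)
  fix x y assume xy: "x \<in> topspace (add_isolated_point X) \<and> y \<in> topspace (add_isolated_point X) \<and> x \<noteq> y"
  have "Some -` {None} = {}"
    by auto
  then have N: "openin (add_isolated_point X) {None}" "openin (add_isolated_point X) (Some ` topspace X)"
    by (metis openin_add_isolated_point openin_empty, metis openin_image_Some openin_topspace)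
  show "\<exists>U V. openin (add_isolated_point X) U \<and> openin (add_isolated_point X) V \<and> x \<in> U \<and> y \<in> V \<and> disjnt U V"
  proof (cases "x = None \<or> y = None")
    case True
    have "disjnt {None} (Some ` topspace X)" "disjnt (Some ` topspace X) {None}"
      by (auto simp: disjnt_def)
    moreover have "x = None \<and> y \<in> Some ` topspace X \<or> y = None \<and> x \<in> Some ` topspace X"
      using True xy by (auto simp: topspace_add_isolated_point)
    ultimately show ?thesis
      using N by blast
  next
    case False
    then obtain a b where ab: "x = Some a" "y = Some b" "a \<in> topspace X" "b \<in> topspace X" "a \<noteq> b"
      using xy by (auto simp: topspace_add_isolated_point)
    then obtain U V where UV: "openin X U" "openin X V" "a \<in> U" "b \<in> V" "disjnt U V"
      using assms unfolding Hausdorff_space_def by blast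
    then have "disjnt (Some ` U) (Some ` V)"
      by (auto simp: disjnt_def)
    then show ?thesis
      using UV ab openin_image_Some by blast
  qed
qed

lemma continuous_map_the:
  "continuous_map (subtopology (add_isolated_point X) (Some ` topspace X)) X the"
proof -
  have "{x \<in> topspace (subtopology (add_isolated_point X) (Some ` topspace X)). the x \<in> U} = Some ` U"
    if "openin X U" for U
    using openin_subset[OF that] by (auto simp: topspace_add_isolated_point)
  then show ?thesis
    by (auto simp: continuous_map_def topspace_add_isolated_point openin_image_Some
        openin_open_subtopology image_mono openin_subset)
qed

text \<open>The map factors as \<open>Some \<circ> f \<circ> the\<close> on the copy of
  \<open>S\<close>. This transports \<alpha> from \<open>M\<close> to a single coordinate of the
  product space.\<close>

lemma continuous_map_map_option:
  assumes "continuous_map (subtopology X S) X f" "openin X S"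
  shows "continuous_map (subtopology (add_isolated_point X) (Some ` S)) (add_isolated_point X)
           (map_option f)"
proof -
  have S: "S \<subseteq> topspace X"
    using assms(2) by (rule openin_subset)
  have "continuous_map (subtopology (add_isolated_point X) (Some ` S)) (subtopology X S) the"
    using continuous_map_from_subtopology_mono[OF continuous_map_the, of "Some ` S" X] S
    by (auto simp: continuous_map_in_subtopology image_mono)
  from continuous_map_compose[OF continuous_map_compose[OF this assms(1)] continuous_map_Some]
  show ?thesis
    by (rule continuous_map_eq) auto
qed

text \<open>A clopen set has empty frontier, so two continuous pieces glue with no matching
  condition between them.\<close>

lemma continuous_map_if_clopen:
  assumes "openin X S" "closedin X S"
    and "continuous_map (subtopology X S) Z f"
    and "continuous_map (subtopology X (topspace X - S)) Z g"
  shows "continuous_map X Z (\<lambda>x. if x \<in> S then f x else g x)"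
proof -
  have "X frontier_of S = {}"
    using assms(1,2) by (simp add: frontier_of_eq_empty closedin_subset)
  moreover have "X closure_of S = S" "X closure_of (topspace X - S) = topspace X - S"
    using assms(1,2) by (simp_all add: closure_of_closedin openin_closedin_eq)
  moreover have "X closure_of {x. x \<notin> S} = X closure_of (topspace X - S)"
    by (subst closure_of_restrict) (simp add: Diff_eq Compl_eq)
  ultimately show ?thesis
    using assms(3,4) by (intro continuous_map_cases) auto
qed

section \<open>The natural extension\<close>

text \<open>Relates entry \<open>n\<close> (\<open>s\<close>) to entry \<open>n + 1\<close>
  (\<open>t\<close>), so that finite and infinite orbits are described at once by conditions on
  neighbouring coordinates. \<open>None\<close> is absorbing: a proper entry \<open>t\<close> forces
  a proper entry \<open>s\<close>.\<close>

definition orbit_step :: "'a pds \<Rightarrow> 'a set \<Rightarrow> 'a option \<Rightarrow> 'a option \<Rightarrow> bool" where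
  "orbit_step A Y s t \<longleftrightarrow>
     (case t of None \<Rightarrow> s = None \<or> s \<in> Some ` Y | Some b \<Rightarrow> b \<in> pdom A \<and> s = Some (pmap A b))"

lemma orbit_step_simps [simp]:
  "orbit_step A Y s None \<longleftrightarrow> s = None \<or> s \<in> Some ` Y"
  "orbit_step A Y s (Some b) \<longleftrightarrow> b \<in> pdom A \<and> s = Some (pmap A b)"
  by (simp_all add: orbit_step_def)

lemma orbit_space_eq:
  "orbit_space A Y =
     {x. x 0 \<in> Some ` topspace (phase A) \<and> (\<forall>n. orbit_step A Y (x n) (x (Suc n)))}" (is "_ = ?R")
proof
  have "x \<in> ?R" if "x \<in> finite_orbits A Y N" for x N
  proof -
    obtain u where x: "x = (\<lambda>n. if n \<le> N then Some (u n) else None)"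
      and u: "u 0 \<in> topspace (phase A)" "\<forall>n \<in> {1..N}. u n \<in> pdom A \<and> pmap A (u n) = u (n - 1)" "u N \<in> Y"
      using \<open>x \<in> finite_orbits A Y N\<close> unfolding finite_orbits_def by blast
    \<comment> \<open>Three cases: inside the orbit (\<open>n < N\<close>), at its last proper
      entry, which lies in \<open>Y\<close> (\<open>n = N\<close>), and in the tail of zeros
      (\<open>n > N\<close>).\<close>
    have "orbit_step A Y (x n) (x (Suc n))" for n
      using u(2)[rule_format, of "Suc n"] u(3) by (cases n N rule: linorder_cases) (auto simp: x)
    then show ?thesis using u(1) by (auto simp: x)
  qed
  moreover have "x \<in> ?R" if "x \<in> infinite_orbits A" for x
  proof -
    obtain u where x: "x = (\<lambda>n. Some (u n))"
      and u: "u 0 \<in> topspace (phase A)" "\<forall>n \<ge> 1. u n \<in> pdom A \<and> pmap A (u n) = u (n - 1)"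
      using \<open>x \<in> infinite_orbits A\<close> unfolding infinite_orbits_def by blast
    then have "orbit_step A Y (x n) (x (Suc n))" for n
      using u(2)[rule_format, of "Suc n"] by simp
    moreover have "x 0 \<in> Some ` topspace (phase A)"
      using u(1) by (simp add: x)
    ultimately show ?thesis by blast
  qed
  ultimately show "orbit_space A Y \<subseteq> ?R"
    unfolding orbit_space_def by blast
next
  show "?R \<subseteq> orbit_space A Y"
  proof
    fix x assume "x \<in> ?R"
    then have x0: "x 0 \<in> Some ` topspace (phase A)" and step: "\<And>n. orbit_step A Y (x n) (x (Suc n))"
      by auto
    define u where "u = the \<circ> x"
    have pred: "x (Suc n) = Some b \<Longrightarrow> b \<in> pdom A \<and> x n = Some (pmap A b)" for n b
      using step[of n] by simp
    have u: "u n \<in> pdom A \<and> pmap A (u n) = u (n - 1)" if "n \<ge> 1" "x n \<noteq> None" for n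
      using that pred[of "n - 1"] by (cases n) (auto simp: u_def)
    have u0: "u 0 \<in> topspace (phase A)"
      using x0 by (auto simp: u_def)
    show "x \<in> orbit_space A Y"
    proof (cases "\<exists>n. x n = None")
      case False
      then have "x = (\<lambda>n. Some (u n))"
        by (auto simp: u_def)
      then have "x \<in> infinite_orbits A"
        using u0 u False unfolding infinite_orbits_def by blast
      then show ?thesis unfolding orbit_space_def by blast
    next
      case True
      define m where "m = (LEAST n. x n = None)"
      have m: "x m = None"
        unfolding m_def using True by (rule LeastI_ex)
      \<comment> \<open>Entry 0 is proper, so the first zero has a predecessor \<open>N\<close>. The
        step from \<open>N\<close> to \<open>m\<close> is the one that puts \<open>u N\<close> into
        \<open>Y\<close>.\<close>
      then obtain N where N: "m = Suc N"
        using x0 by (cases m) auto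
      have lo: "x n \<noteq> None" if "n \<le> N" for n
        using not_less_Least[of n "\<lambda>n. x n = None"] that N by (auto simp: m_def)
      have hi: "x (m + k) = None" for k
        by (induction k) (use m pred in \<open>auto, metis not_None_eq\<close>)
      have "x = (\<lambda>n. if n \<le> N then Some (u n) else None)"
      proof
        fix n show "x n = (if n \<le> N then Some (u n) else None)"
          using lo[of n] hi[of "n - m"] N by (auto simp: u_def)
      qed
      moreover have "u N \<in> Y"
        using step[of N] m lo[of N] by (auto simp: N u_def)
      ultimately have "x \<in> finite_orbits A Y N"
        unfolding finite_orbits_def using u0 u lo by fastforce
      then show ?thesis unfolding orbit_space_def by blast
    qed
  qed
qed

text \<open>Openness is part of reversibility. The range is also the continuous image of the compact
  set \<open>pdom B\<close>, hence compact, hence closed in a Hausdorff space.\<close>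

lemma clopen_pran:
  assumes "partial_dynamical_system B" "reversible B"
  shows "openin (phase B) (pran B)" "closedin (phase B) (pran B)"
proof -
  show "openin (phase B) (pran B)"
    using assms(2) by (simp add: reversible_def)
  have "compactin (subtopology (phase B) (pdom B)) (pdom B)"
    using assms(1) by (auto simp: partial_dynamical_system_def compactin_subtopology closedin_compact_space)
  then have "compactin (phase B) (pran B)"
    using assms(1) unfolding pran_def partial_dynamical_system_def by (blast intro: image_compactin)
  then show "closedin (phase B) (pran B)"
    using assms(1) by (simp add: partial_dynamical_system_def compactin_imp_closedin)
qed

lemma semiconjugacy_compose:
  assumes "semiconjugacy C B f" "semiconjugacy B A g"
  shows "semiconjugacy C A (g \<circ> f)"
proof -
  have "f y \<in> pdom B" if "y \<in> pdom C" for y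
    using assms(1) that unfolding semiconjugacy_def by blast
  moreover have "{x \<in> topspace (phase C). g (f x) \<in> pdom A} = {x \<in> topspace (phase C). f x \<in> pdom B}"
    using assms unfolding semiconjugacy_def by blast
  moreover have "(g \<circ> f) ` topspace (phase C) = topspace (phase A)"
    using assms unfolding semiconjugacy_def by (metis image_comp)
  moreover have "continuous_map (phase C) (phase A) (g \<circ> f)"
    using assms unfolding semiconjugacy_def by (blast intro: continuous_map_compose)
  ultimately show ?thesis
    using assms unfolding semiconjugacy_def by simp
qed

text \<open>Needed for the round trip from the natural extension to \<open>B\<close> and
  back.\<close>

lemma lifting_compose:
  assumes "lifting C \<Xi> B \<Psi> f" "lifting B \<Psi> A \<Phi> g"
  shows "lifting C \<Xi> A \<Phi> (g \<circ> f)"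
proof -
  have "f x \<in> topspace (phase B)" if "x \<in> topspace (phase C)" for x
    using assms(1) that unfolding lifting_def semiconjugacy_def by blast
  moreover have "(g \<circ> f) ` (topspace (phase C) - pran C) = topspace (phase A) - pran A"
    using assms unfolding lifting_def by (metis image_comp)
  ultimately show ?thesis
    using assms semiconjugacy_compose[of C B f A g] unfolding lifting_def by simp
qed

section \<open>Coordinates, shift and range of the natural extension\<close>

locale pds_with_cover =
  fixes A :: "'a pds" and Y :: "'a set"
  assumes pds: "partial_dynamical_system A"
    and closed_Y: "closedin (phase A) Y"
    and cover: "topspace (phase A) - pran A \<subseteq> Y"
begin

abbreviation "E \<equiv> natural_extension A Y"
abbreviation "\<Phi> \<equiv> natural_factor_map :: (nat \<Rightarrow> 'a option) \<Rightarrow> 'a"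
abbreviation "P \<equiv> product_topology (\<lambda>_::nat. add_isolated_point (phase A)) UNIV"

lemma compact_A: "compact_space (phase A)" and Hausdorff_A: "Hausdorff_space (phase A)"
  and open_dom: "openin (phase A) (pdom A)" and closed_dom: "closedin (phase A) (pdom A)"
  and continuous_A: "continuous_map (subtopology (phase A) (pdom A)) (phase A) (pmap A)"
  using pds by (auto simp: partial_dynamical_system_def)

lemma dom_subset: "pdom A \<subseteq> topspace (phase A)" and Y_subset: "Y \<subseteq> topspace (phase A)"
  using open_dom closed_Y by (auto dest: openin_subset closedin_subset)

lemma map_dom: "a \<in> pdom A \<Longrightarrow> pmap A a \<in> topspace (phase A)"
  using continuous_A dom_subset by (auto simp: continuous_map_def)

lemma orbit_spaceD:
  assumes "x \<in> orbit_space A Y"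
  shows "x 0 \<in> Some ` topspace (phase A)" "orbit_step A Y (x n) (x (Suc n))"
  using assms by (auto simp: orbit_space_eq)

lemma orbit_space_nth:
  assumes "x \<in> orbit_space A Y"
  shows "x n \<in> insert None (Some ` topspace (phase A))"
proof (cases n)
  case (Suc m)
  then show ?thesis
    using orbit_spaceD(2)[OF assms, of m] dom_subset by (cases "x (Suc m)") auto
qed (use orbit_spaceD(1)[OF assms] in simp)

lemma orbit_space_subset: "orbit_space A Y \<subseteq> topspace P"
  using orbit_space_nth by (simp add: subset_eq topspace_add_isolated_point PiE_def Pi_iff)

lemma topspace_E: "topspace (phase E) = orbit_space A Y"
  using orbit_space_subset by (auto simp: natural_extension_def)

lemma pdom_E: "pdom E = {x \<in> orbit_space A Y. x 0 \<in> Some ` pdom A}"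
  by (simp add: natural_extension_def)

lemma pmap_E: "pmap E x 0 = map_option (pmap A) (x 0)" "pmap E x (Suc n) = x n"
  by (simp_all add: natural_extension_def)

lemma continuous_projection_E: "continuous_map (phase E) (add_isolated_point (phase A)) (\<lambda>x. x n)"
  using continuous_map_from_subtopology[OF continuous_map_product_projection[of n UNIV]]
  by (simp add: natural_extension_def)

lemma continuous_map_into_E:
  assumes "\<And>n. continuous_map X (add_isolated_point (phase A)) (\<lambda>x. f x n)"
    and "\<And>x. x \<in> topspace X \<Longrightarrow> f x \<in> orbit_space A Y"
  shows "continuous_map X (phase E) f"
  using assms by (auto simp: natural_extension_def continuous_map_in_subtopology continuous_map_componentwise_UNIV)

lemma shift_orbit:
  assumes "x \<in> orbit_space A Y" "x 1 \<noteq> None"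
  shows "(\<lambda>n. x (Suc n)) \<in> pdom E"
proof -
  have "x (Suc 0) \<in> Some ` pdom A"
    using assms(2) orbit_spaceD(2)[OF assms(1), of 0] by auto
  then show ?thesis
    using orbit_spaceD(2)[OF assms(1)] dom_subset by (auto simp: pdom_E orbit_space_eq)
qed

lemma pmap_E_shift: "x \<in> orbit_space A Y \<Longrightarrow> x 1 \<noteq> None \<Longrightarrow> pmap E (\<lambda>n. x (Suc n)) = x"
proof
  fix n assume "x \<in> orbit_space A Y" "x 1 \<noteq> None"
  then show "pmap E (\<lambda>n. x (Suc n)) n = x n"
    using orbit_spaceD(2)[of x 0] by (cases n) (auto simp: pmap_E)
qed

lemma pmap_E_in:
  assumes "x \<in> pdom E" shows "pmap E x \<in> orbit_space A Y"
proof -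
  have "orbit_step A Y (pmap E x n) (pmap E x (Suc n))" for n
    using assms orbit_spaceD(2)[of x] by (cases n) (auto simp: pmap_E pdom_E)
  then show ?thesis
    using assms map_dom by (auto simp: pdom_E pmap_E orbit_space_eq)
qed

text \<open>Entry 1 of an image point is entry 0 of its preimage, hence proper. Conversely, when
  entry 1 is proper, dropping entry 0 yields a preimage.\<close>

lemma pran_E: "pran E = {x \<in> orbit_space A Y. x 1 \<noteq> None}"
proof -
  have "x \<in> pran E" if "x \<in> orbit_space A Y" "x 1 \<noteq> None" for x
    using shift_orbit[OF that] pmap_E_shift[OF that] unfolding pran_def by (metis imageI)
  moreover have "pmap E x 1 \<noteq> None" if "x \<in> pdom E" for x
    using that pmap_E(2)[of x 0] by (auto simp: pdom_E)
  ultimately show ?thesis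
    using pmap_E_in by (auto simp: pran_def)
qed

section \<open>The natural extension is a reversible extension associated with
  \<open>Y\<close>\<close>

lemma closedin_orbit_space: "closedin P (orbit_space A Y)"
proof -
  let ?X = "add_isolated_point (phase A)"
  have proj: "continuous_map P ?X (\<lambda>x. x n)" for n
    using continuous_map_product_projection[of n UNIV "\<lambda>_. add_isolated_point (phase A)"] by simp
  have cl: "closedin P {x \<in> topspace P. x n \<in> C}" if "closedin ?X C" for C n
    using closedin_continuous_map_preimage[OF proj that] .
  \<comment> \<open>The set splits by \<open>x (Suc n)\<close>. On the closed set \<open>?D\<close>,
    where \<alpha> can be applied to this entry, the condition equates two continuous maps into a
    Hausdorff space. Where the entry is \<open>None\<close>, it confines \<open>x n\<close> to a
    closed set.\<close>
  have step: "closedin P {x \<in> topspace P. orbit_step A Y (x n) (x (Suc n))}" for n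
  proof -
    let ?D = "{x \<in> topspace P. x (Suc n) \<in> Some ` pdom A}"
    have D: "closedin P ?D"
      by (intro cl) (simp add: closedin_image_Some closed_dom)
    have "continuous_map (subtopology P ?D) (subtopology ?X (Some ` pdom A)) (\<lambda>x. x (Suc n))"
      unfolding continuous_map_in_subtopology
      by (intro conjI continuous_map_from_subtopology proj) auto
    from continuous_map_compose[OF this continuous_map_map_option[OF continuous_A open_dom]]
    have "continuous_map (subtopology P ?D) ?X (\<lambda>x. map_option (pmap A) (x (Suc n)))"
      by (simp add: o_def)
    then have "closedin (subtopology P ?D)
        {x \<in> topspace (subtopology P ?D). x n = map_option (pmap A) (x (Suc n))}"
      using continuous_map_from_subtopology[OF proj]
      by (intro closedin_continuous_maps_eq[OF Hausdorff_space_add_isolated_point[OF Hausdorff_A]])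
    then have "closedin P {x \<in> topspace (subtopology P ?D). x n = map_option (pmap A) (x (Suc n))}"
      using D by (rule closedin_trans_full)
    moreover have "closedin P ({x \<in> topspace P. x (Suc n) \<in> {None}} \<inter> {x \<in> topspace P. x n \<in> insert None (Some ` Y)})"
      using closedin_Un[OF closedin_None, of "phase A" "Some ` Y"] closed_Y
      by (intro closedin_Int cl) (simp_all add: closedin_None closedin_image_Some)
    ultimately have "closedin P ({x \<in> topspace (subtopology P ?D). x n = map_option (pmap A) (x (Suc n))} \<union>
        {x \<in> topspace P. x (Suc n) \<in> {None}} \<inter> {x \<in> topspace P. x n \<in> insert None (Some ` Y)})"
      by (rule closedin_Un)
    moreover have "\<dots> = {x \<in> topspace P. orbit_step A Y (x n) (x (Suc n))}"
    proof (rule set_eqI)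
      fix x
      show "x \<in> {x \<in> topspace (subtopology P ?D). x n = map_option (pmap A) (x (Suc n))} \<union>
        {x \<in> topspace P. x (Suc n) \<in> {None}} \<inter> {x \<in> topspace P. x n \<in> insert None (Some ` Y)} \<longleftrightarrow>
        x \<in> {x \<in> topspace P. orbit_step A Y (x n) (x (Suc n))}"
        by (cases "x (Suc n)") auto
    qed
    ultimately show ?thesis by simp
  qed
  have "orbit_space A Y = {x \<in> topspace P. x 0 \<in> Some ` topspace (phase A)} \<inter>
      (\<Inter>n. {x \<in> topspace P. orbit_step A Y (x n) (x (Suc n))})"
    using orbit_space_subset by (auto simp: orbit_space_eq)
  moreover have "closedin P {x \<in> topspace P. x 0 \<in> Some ` topspace (phase A)}"
    by (intro cl) (simp add: closedin_image_Some)
  ultimately show ?thesis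
    using step by (auto intro!: closedin_Int closedin_INT)
qed

lemma pds_E: "partial_dynamical_system E"
  unfolding partial_dynamical_system_def
proof (intro conjI)
  let ?X = "add_isolated_point (phase A)"
  \<comment> \<open>Tychonoff's theorem; the closed subset \<open>orbit_space A Y\<close> inherits
    compactness.\<close>
  have "compact_space P"
    by (simp add: compact_space_product_topology compact_space_add_isolated_point compact_A)
  then show "compact_space (phase E)"
    using closedin_orbit_space
    by (simp add: natural_extension_def compact_space_subtopology closedin_compact_space)
  show "Hausdorff_space (phase E)"
    by (simp add: natural_extension_def Hausdorff_space_subtopology Hausdorff_space_product_topology
        Hausdorff_space_add_isolated_point Hausdorff_A)
  have dom: "pdom E = {x \<in> topspace (phase E). x 0 \<in> Some ` pdom A}"
    by (simp add: pdom_E topspace_E)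
  show "openin (phase E) (pdom E)"
    unfolding dom using open_dom
    by (intro openin_continuous_map_preimage[OF continuous_projection_E]) (simp add: openin_image_Some)
  show "closedin (phase E) (pdom E)"
    unfolding dom using closed_dom
    by (intro closedin_continuous_map_preimage[OF continuous_projection_E]) (simp add: closedin_image_Some)
  show "continuous_map (subtopology (phase E) (pdom E)) (phase E) (pmap E)"
  proof (rule continuous_map_into_E)
    fix n
    have "continuous_map (subtopology (phase E) (pdom E)) (subtopology ?X (Some ` pdom A)) (\<lambda>x. x 0)"
      unfolding continuous_map_in_subtopology
      by (intro conjI continuous_map_from_subtopology continuous_projection_E) (auto simp: pdom_E)
    from continuous_map_compose[OF this continuous_map_map_option[OF continuous_A open_dom]]
    show "continuous_map (subtopology (phase E) (pdom E)) ?X (\<lambda>x. pmap E x n)"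
      by (cases n) (simp_all add: o_def pmap_E continuous_map_from_subtopology continuous_projection_E)
  next
    show "pmap E x \<in> orbit_space A Y" if "x \<in> topspace (subtopology (phase E) (pdom E))" for x
      using that by (simp add: pmap_E_in)
  qed
qed

lemma reversible_E: "reversible E"
proof -
  \<comment> \<open>Presents the range as the preimage of an open set under the projection to
    coordinate 1.\<close>
  have ran: "pran E = {x \<in> topspace (phase E). x 1 \<in> Some ` topspace (phase A)}"
    using orbit_space_nth[of _ 1] by (fastforce simp: pran_E topspace_E)
  have "openin (phase E) (pran E)"
    unfolding ran by (intro openin_continuous_map_preimage[OF continuous_projection_E]) (simp add: openin_image_Some)
  moreover have "homeomorphic_maps (subtopology (phase E) (pdom E)) (subtopology (phase E) (pran E))
      (pmap E) (\<lambda>x n. x (Suc n))"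
    unfolding homeomorphic_maps_def
  proof (intro conjI ballI)
    show "continuous_map (subtopology (phase E) (pdom E)) (subtopology (phase E) (pran E)) (pmap E)"
      using pds_E by (auto simp: partial_dynamical_system_def continuous_map_in_subtopology pran_def)
    show "continuous_map (subtopology (phase E) (pran E)) (subtopology (phase E) (pdom E)) (\<lambda>x n. x (Suc n))"
      unfolding continuous_map_in_subtopology
    proof (intro conjI continuous_map_into_E)
      show "continuous_map (subtopology (phase E) (pran E)) (add_isolated_point (phase A)) (\<lambda>x. x (Suc n))" for n
        by (intro continuous_map_from_subtopology continuous_projection_E)
    qed (use shift_orbit in \<open>auto simp: pran_E pdom_E\<close>)
    show "pmap E (\<lambda>n. y (Suc n)) = y" if "y \<in> topspace (subtopology (phase E) (pran E))" for y
      using that pmap_E_shift by (simp add: pran_E)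
  qed (simp add: pmap_E)
  ultimately show ?thesis
    unfolding reversible_def by (blast intro: homeomorphic_maps_imp_map)
qed

text \<open>Gives surjectivity of \<open>\<Phi>\<close>. A backward orbit is continued by chosen
  preimages until it meets \<open>Y\<close>; a point outside \<open>Y\<close> has a preimage because
  \<open>Y\<close> covers the complement of the range.\<close>

lemma ex_orbit:
  assumes "a \<in> topspace (phase A)"
  obtains x where "x \<in> orbit_space A Y" "x 0 = Some a"
proof -
  define next_pt where "next_pt b = (if b \<in> Y then None else Some (inv_into (pdom A) (pmap A) b))" for b
  \<comment> \<open>\<open>Option.bind\<close> keeps \<open>None\<close> fixed, so the sequence
    stays at zero once it has stopped in \<open>Y\<close>.\<close>
  define x where "x = rec_nat (Some a) (\<lambda>_ s. Option.bind s next_pt)"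
  have x: "x 0 = Some a" "x (Suc n) = Option.bind (x n) next_pt" for n
    by (simp_all add: x_def)
  have next_pt: "orbit_step A Y (Some b) (next_pt b)" if "b \<in> topspace (phase A)" for b
    using that cover by (auto simp: next_pt_def pran_def inv_into_into f_inv_into_f)
  have top: "x n \<in> insert None (Some ` topspace (phase A))" for n
  proof (induction n)
    case (Suc n)
    show ?case
    proof (cases "x n")
      case (Some b)
      then have "orbit_step A Y (Some b) (x (Suc n))"
        using Suc next_pt by (auto simp: x)
      then show ?thesis
        using dom_subset by (cases "x (Suc n)") auto
    qed (simp add: x)
  qed (simp add: x assms)
  have "orbit_step A Y (x n) (x (Suc n))" for n
    using top[of n] next_pt by (cases "x n") (auto simp: x)
  then have "x \<in> orbit_space A Y"
    by (simp add: orbit_space_eq x assms)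
  with x(1) show ?thesis by (rule that[rotated])
qed

text \<open>By \<open>pran_E\<close> the points outside the range have entry 1 equal to zero: they
  are the sequences \<open>(y, 0, 0, ...)\<close> with \<open>y\<close> in \<open>Y\<close>.\<close>

lemma complement_E_image: "\<Phi> ` (topspace (phase E) - pran E) = Y"
proof
  show "\<Phi> ` (topspace (phase E) - pran E) \<subseteq> Y"
  proof clarsimp
    fix x assume "x \<in> topspace (phase E)" "x \<notin> pran E"
    then have x: "x \<in> orbit_space A Y" "x (Suc 0) = None"
      by (auto simp: topspace_E pran_E)
    show "\<Phi> x \<in> Y"
      using orbit_spaceD(1)[OF x(1)] orbit_spaceD(2)[OF x(1), of 0] x(2)
      by (auto simp: natural_factor_map_def)
  qed
  show "Y \<subseteq> \<Phi> ` (topspace (phase E) - pran E)"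
  proof
    fix y assume y: "y \<in> Y"
    let ?x = "\<lambda>n. if n = 0 then Some y else None"
    have "?x \<in> topspace (phase E) - pran E"
      using y Y_subset by (auto simp: topspace_E pran_E orbit_space_eq)
    moreover have "\<Phi> ?x = y"
      by (simp add: natural_factor_map_def)
    ultimately show "y \<in> \<Phi> ` (topspace (phase E) - pran E)"
      by (metis imageI)
  qed
qed

lemma reversible_extension_E: "reversible_extension E A Y \<Phi>"
proof -
  have "continuous_map (phase E) (subtopology (add_isolated_point (phase A)) (Some ` topspace (phase A))) (\<lambda>x. x 0)"
    unfolding continuous_map_in_subtopology
    using continuous_projection_E orbit_spaceD(1) by (auto simp: topspace_E)
  from continuous_map_compose[OF this continuous_map_the]
  have "continuous_map (phase E) (phase A) \<Phi>"
    by (simp add: o_def natural_factor_map_def[abs_def])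
  moreover have "\<Phi> ` topspace (phase E) = topspace (phase A)"
  proof
    show "\<Phi> ` topspace (phase E) \<subseteq> topspace (phase A)"
      using orbit_spaceD(1) by (force simp: topspace_E natural_factor_map_def)
    show "topspace (phase A) \<subseteq> \<Phi> ` topspace (phase E)"
    proof
      fix a assume "a \<in> topspace (phase A)"
      then obtain x where "x \<in> orbit_space A Y" "x 0 = Some a"
        by (rule ex_orbit)
      then show "a \<in> \<Phi> ` topspace (phase E)"
        by (force simp: topspace_E natural_factor_map_def)
    qed
  qed
  moreover have "{x \<in> topspace (phase E). \<Phi> x \<in> pdom A} = pdom E"
    using orbit_spaceD(1) by (force simp: topspace_E pdom_E natural_factor_map_def)
  moreover have "pmap A (\<Phi> x) = \<Phi> (pmap E x)" if "x \<in> pdom E" for x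
    using that by (auto simp: pdom_E natural_factor_map_def pmap_E)
  ultimately have "semiconjugacy E A \<Phi>"
    by (simp add: semiconjugacy_def)
  \<comment> \<open>The complement is its own closure, so \<open>complement_E_image\<close> is the
    required association with \<open>Y\<close>.\<close>
  moreover have "closedin (phase E) (topspace (phase E) - pran E)"
    using clopen_pran[OF pds_E reversible_E] by blast
  ultimately show ?thesis
    by (simp add: reversible_extension_def extension_associated_def reversible_E pds_E
        closure_of_closedin complement_E_image)
qed

end

section \<open>Lifting an arbitrary reversible extension\<close>

text \<open>Coordinate \<open>n\<close> is \<open>\<Psi>\<close> at the \<open>n\<close>-th backward
  iterate of \<open>y\<close> under \<beta>, or \<open>None\<close> if that iterate does not exist.
  The index precedes the point so that each coordinate is a map on the phase space of
  \<open>B\<close>.\<close>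

primrec lift_coord :: "'b pds \<Rightarrow> ('b \<Rightarrow> 'a) \<Rightarrow> nat \<Rightarrow> 'b \<Rightarrow> 'a option" where
  "lift_coord B \<Psi> 0 y = Some (\<Psi> y)"
| "lift_coord B \<Psi> (Suc n) y =
     (if y \<in> pran B then lift_coord B \<Psi> n (inv_into (pdom B) (pmap B) y) else None)"

locale associated_reversible_extension = pds_with_cover A Y for A :: "'a pds" and Y +
  fixes B :: "'b pds" and \<Psi> :: "'b \<Rightarrow> 'a"
  assumes ext: "reversible_extension B A Y \<Psi>"
begin

abbreviation "\<Psi>E \<equiv> \<lambda>y n. lift_coord B \<Psi> n y"
abbreviation "inv_B \<equiv> inv_into (pdom B) (pmap B)"

section \<open>Consequences of being a reversible extension associated with \<open>Y\<close>\<close>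

lemma pds_B: "partial_dynamical_system B" and reversible_B: "reversible B"
  and semiconj_B: "semiconjugacy B A \<Psi>"
  using ext by (auto simp: reversible_extension_def extension_associated_def)

lemmas open_ran_B = clopen_pran(1)[OF pds_B reversible_B]
  and closed_ran_B = clopen_pran(2)[OF pds_B reversible_B]

lemma closure_complement_B:
  "phase B closure_of (topspace (phase B) - pran B) = topspace (phase B) - pran B"
  using open_ran_B by (intro closure_of_closedin) blast

lemma complement_B_image: "\<Psi> ` (topspace (phase B) - pran B) = Y"
  using ext closure_complement_B by (simp add: reversible_extension_def extension_associated_def)

lemma dom_B: "pdom B = {y \<in> topspace (phase B). \<Psi> y \<in> pdom A}"
  and \<Psi>_pmap: "y \<in> pdom B \<Longrightarrow> \<Psi> (pmap B y) = pmap A (\<Psi> y)"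
  and \<Psi>_image: "\<Psi> ` topspace (phase B) = topspace (phase A)"
  and continuous_\<Psi>: "continuous_map (phase B) (phase A) \<Psi>"
  using semiconj_B by (auto simp: semiconjugacy_def)

lemma ran_B_subset: "pran B \<subseteq> topspace (phase B)"
  using open_ran_B by (rule openin_subset)

lemma inv_B: "y \<in> pran B \<Longrightarrow> inv_B y \<in> pdom B" "y \<in> pran B \<Longrightarrow> pmap B (inv_B y) = y"
  by (auto simp: pran_def inv_into_into f_inv_into_f)

lemma inj_B: "inj_on (pmap B) (pdom B)"
proof -
  have "pdom B \<subseteq> topspace (phase B)"
    by (auto simp: dom_B)
  then show ?thesis
    using reversible_B homeomorphic_imp_injective_map unfolding reversible_def
    by (metis topspace_subtopology_subset)
qed

lemma inv_B_pmap: "y \<in> pdom B \<Longrightarrow> inv_B (pmap B y) = y"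
  using inj_B by simp

lemma continuous_inv_B: "continuous_map (subtopology (phase B) (pran B)) (phase B) inv_B"
proof -
  obtain g where g: "homeomorphic_maps (subtopology (phase B) (pdom B)) (subtopology (phase B) (pran B)) (pmap B) g"
    using reversible_B by (auto simp: reversible_def homeomorphic_map_maps)
  then have "continuous_map (subtopology (phase B) (pran B)) (phase B) g"
    by (auto simp: homeomorphic_maps_def continuous_map_in_subtopology)
  \<comment> \<open>Apply \<open>g\<close>, a left inverse of \<open>pmap B\<close> on the domain,
    to \<open>pmap B (inv_B y) = y\<close>.\<close>
  moreover have "g y = inv_B y" if "y \<in> topspace (subtopology (phase B) (pran B))" for y
  proof -
    have "inv_B y \<in> pdom B" "pmap B (inv_B y) = y"
      using that inv_B by simp_all
    then show ?thesis
      using g dom_B unfolding homeomorphic_maps_def by (metis IntI mem_Collect_eq topspace_subtopology)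
  qed
  ultimately show ?thesis
    by (rule continuous_map_eq)
qed

section \<open>The lifting map: values, continuity and commutation with the dynamics\<close>

lemma lift_in_orbit_space:
  assumes "y \<in> topspace (phase B)"
  shows "\<Psi>E y \<in> orbit_space A Y"
proof -
  have "orbit_step A Y (\<Psi>E y n) (\<Psi>E y (Suc n))" for n
    using assms
  proof (induction n arbitrary: y)
    case 0
    show ?case
    proof (cases "y \<in> pran B")
      case True
      then show ?thesis
        using inv_B[of y] \<Psi>_pmap[of "inv_B y"] by (simp add: dom_B)
    next
      case False
      \<comment> \<open>Outside the range the orbit stops at once, and there \<open>\<Psi>\<close>
        takes its values in \<open>Y\<close>.\<close>
      then show ?thesis
        using 0 complement_B_image by auto
    qed
  next
    case (Suc n)
    \<comment> \<open>On the range, step \<open>Suc n\<close> at \<open>y\<close> is step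
      \<open>n\<close> at the preimage of \<open>y\<close>; outside it both entries are
      \<open>None\<close>.\<close>
    have "inv_B y \<in> topspace (phase B)" if "y \<in> pran B"
      using inv_B(1)[OF that] by (simp add: dom_B)
    then show ?case
      using Suc.IH[of "inv_B y"] by simp
  qed
  moreover have "\<Psi>E y 0 \<in> Some ` topspace (phase A)"
    using assms \<Psi>_image by auto
  ultimately show ?thesis
    by (simp only: orbit_space_eq mem_Collect_eq) blast
qed

lemma continuous_lift_coord:
  "continuous_map (phase B) (add_isolated_point (phase A)) (lift_coord B \<Psi> n)"
proof (induction n)
  case 0
  show ?case
    using continuous_map_compose[OF continuous_\<Psi> continuous_map_Some] by (simp add: o_def)
next
  case (Suc n)
  have "continuous_map (subtopology (phase B) (pran B)) (add_isolated_point (phase A))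
      (\<lambda>y. lift_coord B \<Psi> n (inv_B y))"
    using continuous_map_compose[OF continuous_inv_B Suc] by (simp add: o_def)
  then show ?case
    using open_ran_B closed_ran_B
    by (simp add: continuous_map_if_clopen topspace_add_isolated_point)
qed

text \<open>The preimage of \<open>pmap B y\<close> is \<open>y\<close>, so its sequence is
  \<open>\<Psi> (pmap B y)\<close> followed by the sequence of \<open>y\<close>.\<close>

lemma lift_pmap:
  assumes "y \<in> pdom B"
  shows "\<Psi>E (pmap B y) = pmap E (\<Psi>E y)"
proof
  fix n
  have "pmap B y \<in> pran B"
    using assms by (simp add: pran_def)
  then show "\<Psi>E (pmap B y) n = pmap E (\<Psi>E y) n"
    using assms by (cases n) (simp_all add: pmap_E \<Psi>_pmap inv_B_pmap)
qed

text \<open>Both sides consist of the sequences \<open>(a, 0, 0, ...)\<close> with \<open>a\<close>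
  in \<open>Y\<close>, since \<open>\<Psi>\<close> maps the complement of the range of \<beta> onto
  \<open>Y\<close>.\<close>

lemma lift_complement:
  "\<Psi>E ` (topspace (phase B) - pran B) = topspace (phase E) - pran E"
proof
  show "\<Psi>E ` (topspace (phase B) - pran B) \<subseteq> topspace (phase E) - pran E"
    using lift_in_orbit_space by (auto simp: topspace_E pran_E)
  show "topspace (phase E) - pran E \<subseteq> \<Psi>E ` (topspace (phase B) - pran B)"
  proof
    fix e assume e: "e \<in> topspace (phase E) - pran E"
    then have "\<Phi> e \<in> Y"
      using complement_E_image by blast
    then obtain y where y: "y \<in> topspace (phase B) - pran B" "\<Psi> y = \<Phi> e"
      using complement_B_image by (metis imageE)
    have eo: "e \<in> orbit_space A Y" "e 1 = None"
      using e by (auto simp: topspace_E pran_E)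
    have tail: "e (Suc n) = None" for n
    proof (induction n)
      case (Suc n)
      then show ?case
        using orbit_spaceD(2)[OF eo(1), of "Suc n"] by (cases "e (Suc (Suc n))") auto
    qed (use eo in simp)
    have "\<Psi>E y = e"
    proof
      fix n show "\<Psi>E y n = e n"
        using y tail orbit_spaceD(1)[OF eo(1)] by (cases n) (auto simp: natural_factor_map_def)
    qed
    then show "e \<in> \<Psi>E ` (topspace (phase B) - pran B)"
      using y(1) by (metis imageI)
  qed
qed

text \<open>Induction by shifting: a point matching the first entries of the shifted sequence is
  moved forward once by \<beta>. A sequence outside the range is hit exactly, by
  \<open>lift_complement\<close>.\<close>

lemma lift_approx:
  assumes "e \<in> orbit_space A Y"
  shows "\<exists>y \<in> topspace (phase B). \<forall>n\<le>N. \<Psi>E y n = e n"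
  using assms
proof (induction N arbitrary: e)
  case 0
  then obtain a where "a \<in> topspace (phase A)" "e 0 = Some a"
    using orbit_spaceD(1) by blast
  moreover from this obtain y where "y \<in> topspace (phase B)" "\<Psi> y = a"
    using \<Psi>_image by (metis imageE)
  ultimately show ?case
    by (intro bexI[of _ y]) auto
next
  case (Suc N)
  show ?case
  proof (cases "e \<in> pran E")
    case False
    then have "e \<in> \<Psi>E ` (topspace (phase B) - pran B)"
      using Suc.prems by (simp add: lift_complement topspace_E)
    then show ?thesis by blast
  next
    case True
    then have e1: "e 1 \<noteq> None"
      by (simp add: pran_E)
    have "(\<lambda>n. e (Suc n)) \<in> orbit_space A Y"
      using shift_orbit[OF Suc.prems e1] by (simp add: pdom_E)
    from Suc.IH[OF this] obtain y where y: "y \<in> topspace (phase B)" "\<And>n. n \<le> N \<Longrightarrow> \<Psi>E y n = e (Suc n)"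
      by blast
    \<comment> \<open>Matching at index 0 gives \<open>\<Psi> y\<close> the value of entry 1 of
      \<open>e\<close>, which lies in the domain of \<alpha>; hence \<beta> can be applied to
      \<open>y\<close>.\<close>
    have "Some (\<Psi> y) \<in> Some ` pdom A"
      using shift_orbit[OF Suc.prems e1] y(2)[of 0] by (simp add: pdom_E)
    then have yd: "y \<in> pdom B"
      using y(1) by (auto simp: dom_B)
    have "\<Psi>E (pmap B y) n = e n" if "n \<le> Suc N" for n
    proof -
      have "pmap E (\<Psi>E y) n = pmap E (\<lambda>n. e (Suc n)) n"
        using that y(2) by (cases n) (auto simp: pmap_E simp del: lift_coord.simps)
      then show ?thesis
        using lift_pmap[OF yd] pmap_E_shift[OF Suc.prems e1] by metis
    qed
    moreover have "pmap B y \<in> topspace (phase B)"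
      using yd ran_B_subset by (auto simp: pran_def)
    ultimately show ?thesis by blast
  qed
qed

lemma lift_image: "\<Psi>E ` topspace (phase B) = topspace (phase E)"
proof
  show "\<Psi>E ` topspace (phase B) \<subseteq> topspace (phase E)"
    using lift_in_orbit_space by (auto simp: topspace_E)
  show "topspace (phase E) \<subseteq> \<Psi>E ` topspace (phase B)"
  proof
    fix e assume "e \<in> topspace (phase E)"
    then have e: "e \<in> orbit_space A Y"
      by (simp add: topspace_E)
    \<comment> \<open>A decreasing sequence of closed sets, nonempty by \<open>lift_approx\<close>.
      Compactness yields a common point, which matches \<open>e\<close> in every coordinate.\<close>
    define K where "K N = {y \<in> topspace (phase B). \<forall>n\<le>N. \<Psi>E y n = e n}" for N :: nat
    have closed: "closedin (phase B) (K N)" for N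
    proof -
      have "closedin (phase B) {y \<in> topspace (phase B). lift_coord B \<Psi> n y \<in> {e n}}" for n
      proof (rule closedin_continuous_map_preimage[OF continuous_lift_coord])
        have "e n \<in> topspace (add_isolated_point (phase A))"
          using orbit_space_nth[OF e] by (simp add: topspace_add_isolated_point)
        then show "closedin (add_isolated_point (phase A)) {e n}"
          using closedin_Hausdorff_sing_eq[OF Hausdorff_space_add_isolated_point[OF Hausdorff_A]] by simp
      qed
      then have "closedin (phase B) (\<Inter>n\<in>{..N}. {y \<in> topspace (phase B). lift_coord B \<Psi> n y \<in> {e n}})"
        by (intro closedin_INT) auto
      moreover have "(\<Inter>n\<in>{..N}. {y \<in> topspace (phase B). lift_coord B \<Psi> n y \<in> {e n}}) = K N"
        by (auto simp: K_def)
      ultimately show ?thesis by simp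
    qed
    have "K N \<noteq> {}" for N
      using lift_approx[OF e, of N] by (auto simp: K_def)
    moreover have "decseq K"
      by (force simp: decseq_def K_def)
    moreover have "compact_space (phase B)"
      using pds_B by (simp add: partial_dynamical_system_def)
    ultimately have "(\<Inter>N. K N) \<noteq> {}"
      using closed by (intro compact_space_imp_nest)
    then obtain y where y: "\<And>N. y \<in> K N" by blast
    then have "\<Psi>E y = e"
      by (auto simp: K_def)
    moreover have "y \<in> topspace (phase B)"
      using y by (auto simp: K_def)
    ultimately show "e \<in> \<Psi>E ` topspace (phase B)" by (metis imageI)
  qed
qed

lemma lifting_lift: "lifting B \<Psi> E \<Phi> \<Psi>E"
proof -
  have "continuous_map (phase B) (phase E) \<Psi>E"
    by (intro continuous_map_into_E continuous_lift_coord lift_in_orbit_space)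
  moreover have "{y \<in> topspace (phase B). \<Psi>E y \<in> pdom E} = pdom B"
    using lift_in_orbit_space by (auto simp: dom_B pdom_E)
  ultimately have "semiconjugacy B E \<Psi>E"
    by (simp add: semiconjugacy_def lift_image lift_pmap)
  then show ?thesis
    by (simp add: lifting_def lift_complement natural_factor_map_def)
qed

text \<open>The conditions on a lifting reproduce the recursion of \<open>lift_coord\<close>:
  \<open>\<Phi>\<close> fixes entry 0, commutation with the dynamics fixes the tail on the range of
  \<beta>, and the complement condition makes the tail zero elsewhere.\<close>

lemma lifting_eq:
  assumes "lifting B \<Psi> E \<Phi> \<Psi>'" "y \<in> topspace (phase B)"
  shows "\<Psi>' y = \<Psi>E y"
proof
  fix n
  have in_E: "\<Psi>' z \<in> orbit_space A Y" and \<Phi>: "\<Phi> (\<Psi>' z) = \<Psi> z" if "z \<in> topspace (phase B)" for z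
    using assms(1) that unfolding lifting_def semiconjugacy_def topspace_E by auto
  have comm: "\<Psi>' (pmap B z) = pmap E (\<Psi>' z)" if "z \<in> pdom B" for z
    using assms(1) that by (simp add: lifting_def semiconjugacy_def)
  have out: "\<Psi>' z 1 = None" if "z \<in> topspace (phase B)" "z \<notin> pran B" for z
    using assms(1) that in_E unfolding lifting_def pran_E by blast
  \<comment> \<open>Extends the vanishing of entry 1 to the whole tail, as \<open>None\<close> is
    absorbing.\<close>
  have out: "\<Psi>' z (Suc n) = None" if "z \<in> topspace (phase B)" "z \<notin> pran B" for z n
  proof (induction n)
    case (Suc n)
    then show ?case
      using orbit_spaceD(2)[OF in_E[OF that(1)], of "Suc n"] by (cases "\<Psi>' z (Suc (Suc n))") auto
  qed (use out that in simp)
  show "\<Psi>' y n = \<Psi>E y n"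
    using assms(2)
  proof (induction n arbitrary: y)
    case 0
    then show ?case
      using \<Phi>[of y] orbit_spaceD(1)[OF in_E] by (force simp: natural_factor_map_def)
  next
    case (Suc n)
    show ?case
    proof (cases "y \<in> pran B")
      case True
      then have "\<Psi>' y (Suc n) = \<Psi>' (inv_B y) n"
        using comm[OF inv_B(1)[OF True]] inv_B(2)[OF True] by (simp add: pmap_E)
      then show ?thesis
        using True Suc.IH[of "inv_B y"] inv_B(1)[OF True] by (simp add: dom_B)
    qed (use out Suc.prems in simp)
  qed
qed

lemma lifting_unique:
  "\<exists>!\<Psi>'. \<Psi>' \<in> extensional (topspace (phase B)) \<and> lifting B \<Psi> E \<Phi> \<Psi>'"
proof
  let ?R = "restrict \<Psi>E (topspace (phase B))"
  \<comment> \<open>Both arguments in the commutation relation lie in the phase space, so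
    restricting \<open>\<Psi>E\<close> leaves that relation intact.\<close>
  have dom: "y \<in> topspace (phase B)" "pmap B y \<in> topspace (phase B)" if "y \<in> pdom B" for y
    using that ran_B_subset by (auto simp: dom_B pran_def)
  have "continuous_map (phase B) (phase E) ?R"
    using lifting_lift unfolding lifting_def semiconjugacy_def
    by (auto intro: continuous_map_eq[of _ _ \<Psi>E])
  then have "lifting B \<Psi> E \<Phi> ?R"
    using lifting_lift dom unfolding lifting_def semiconjugacy_def
    by (auto cong: conj_cong)
  then show "?R \<in> extensional (topspace (phase B)) \<and> lifting B \<Psi> E \<Phi> ?R"
    by simp
  fix \<Psi>' assume "\<Psi>' \<in> extensional (topspace (phase B)) \<and> lifting B \<Psi> E \<Phi> \<Psi>'"
  then show "\<Psi>' = ?R"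
    using lifting_eq by (intro extensionalityI[of _ "topspace (phase B)"]) auto
qed

text \<open>The composite \<open>\<Psi>' \<circ> \<Xi>'\<close> lifts the natural extension to
  itself, so uniqueness makes it the identity. As \<open>\<Xi>'\<close> is onto, it is then a left
  inverse of \<open>\<Psi>'\<close>.\<close>

lemma lifting_inj_on:
  assumes "lifting B \<Psi> E \<Phi> \<Psi>'" "lifting E \<Phi> B \<Psi> \<Xi>'"
  shows "inj_on \<Psi>' (topspace (phase B))"
proof -
  \<comment> \<open>The natural extension takes the role of \<open>B\<close>, so
    \<open>lifting_eq\<close> compares its self-liftings, among them the identity.\<close>
  interpret E: associated_reversible_extension A Y E \<Phi>
    by unfold_locales (rule reversible_extension_E)
  have id: "lifting E \<Phi> E \<Phi> (\<lambda>x. x)"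
    by (auto simp: lifting_def semiconjugacy_def topspace_E pdom_E)
  have "\<Psi>' (\<Xi>' e) = e" if "e \<in> topspace (phase E)" for e
    using E.lifting_eq[OF lifting_compose[OF assms(2,1)] that] E.lifting_eq[OF id that] by simp
  moreover have "\<Xi>' ` topspace (phase E) = topspace (phase B)"
    using assms(2) by (simp add: lifting_def semiconjugacy_def)
  ultimately have "\<Xi>' (\<Psi>' y) = y" if "y \<in> topspace (phase B)" for y
    using that by (metis imageE)
  then show ?thesis
    by (intro inj_on_inverseI[where g = "\<Xi>'"]) auto
qed

end

(* In part ii) the test systems T range over the type that carries the natural extension, since
   HOL cannot quantify over types inside a formula. *)
theorem theorem2p14:
  fixes A :: "'a pds" and Y :: "'a set"
    and E :: "(nat \<Rightarrow> 'a option) pds" and \<Phi> :: "(nat \<Rightarrow> 'a option) \<Rightarrow> 'a"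
  assumes "partial_dynamical_system A"
    and "closedin (phase A) Y"
    and "topspace (phase A) - pran A \<subseteq> Y"
    and "E = natural_extension A Y"
    and "\<Phi> = natural_factor_map"
  shows
    "(\<forall>(B :: 'b pds) \<Psi>. reversible_extension B A Y \<Psi> \<longrightarrow>
        (\<exists>!\<Psi>'. \<Psi>' \<in> extensional (topspace (phase B)) \<and> lifting B \<Psi> E \<Phi> \<Psi>') \<and>
        (\<forall>\<Psi>'. lifting B \<Psi> E \<Phi> \<Psi>' \<longrightarrow>
           extension_associated B E (topspace (phase E) - pran E) \<Psi>')) \<and>
     (\<forall>(B :: 'b pds) \<Psi>. reversible_extension B A Y \<Psi> \<longrightarrow>
        (\<forall>(T :: (nat \<Rightarrow> 'a option) pds) \<Xi>. reversible_extension T A Y \<Xi> \<longrightarrow>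
           (\<exists>!\<Xi>'. \<Xi>' \<in> extensional (topspace (phase T)) \<and> lifting T \<Xi> B \<Psi> \<Xi>')) \<longrightarrow>
        equivalent_systems B E \<and>
        (\<forall>\<Psi>'. lifting B \<Psi> E \<Phi> \<Psi>' \<longrightarrow>
           semiconjugacy B E \<Psi>' \<and> inj_on \<Psi>' (topspace (phase B))))"
proof -
  interpret N: pds_with_cover A Y
    using assms by unfold_locales
  have E: "E = natural_extension A Y" and \<Phi>: "\<Phi> = natural_factor_map"
    by (fact assms)+
  have ext: "associated_reversible_extension A Y B \<Psi>" if "reversible_extension B A Y \<Psi>"
    for B :: "'b pds" and \<Psi>
    using that by unfold_locales
  show ?thesis
    unfolding E \<Phi>
  proof (intro conjI allI impI)
    fix B :: "'b pds" and \<Psi> assume B: "reversible_extension B A Y \<Psi>"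
    interpret B: associated_reversible_extension A Y B \<Psi>
      using B by (rule ext)
    show "\<exists>!\<Psi>'. \<Psi>' \<in> extensional (topspace (phase B)) \<and>
        lifting B \<Psi> (natural_extension A Y) natural_factor_map \<Psi>'"
      by (rule B.lifting_unique)
    fix \<Psi>' assume "lifting B \<Psi> (natural_extension A Y) natural_factor_map \<Psi>'"
    then show "extension_associated B (natural_extension A Y)
        (topspace (phase (natural_extension A Y)) - pran (natural_extension A Y)) \<Psi>'"
      by (simp add: extension_associated_def lifting_def B.pds_B B.closure_complement_B)
  next
    fix B :: "'b pds" and \<Psi> assume B: "reversible_extension B A Y \<Psi>"
      and univ: "\<forall>(T :: (nat \<Rightarrow> 'a option) pds) \<Xi>. reversible_extension T A Y \<Xi> \<longrightarrow>
        (\<exists>!\<Xi>'. \<Xi>' \<in> extensional (topspace (phase T)) \<and> lifting T \<Xi> B \<Psi> \<Xi>')"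
    interpret B: associated_reversible_extension A Y B \<Psi>
      using B by (rule ext)
    \<comment> \<open>The universal property of \<open>B\<close> is tested on the natural extension
      itself.\<close>
    obtain \<Xi>' where \<Xi>': "lifting (natural_extension A Y) natural_factor_map B \<Psi> \<Xi>'"
      using univ N.reversible_extension_E by blast
    show *: "semiconjugacy B (natural_extension A Y) \<Psi>'" "inj_on \<Psi>' (topspace (phase B))"
      if "lifting B \<Psi> (natural_extension A Y) natural_factor_map \<Psi>'" for \<Psi>'
      using that B.lifting_inj_on[OF that \<Xi>'] by (simp_all add: lifting_def)
    \<comment> \<open>The canonical lifting \<open>\<Psi>E\<close> from the first part is the
      injective semiconjugacy.\<close>
    show "equivalent_systems B (natural_extension A Y)"
      using *[OF B.lifting_lift] unfolding equivalent_systems_def by blast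
  qed
qed

end
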